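(* Let $\mathcal H$ be a finite-dimensional real Hilbert space, $\mathcal X\subset\mathcal H$ a nonempty open convex set, $c(x,y)=\|x-y\|_{\mathcal H}^2$, and let $\rho\in\mathcal P(\mathcal X)$ satisfy $\rho\ll\mathcal L_{\mathcal H}$ and $\int_{\mathcal X}\|x\|_{\mathcal H}^2\,d\rho(x)<\infty$. Let $G$ be a Lie group acting smoothly on $\mathcal X$ via $\alpha:G\to\mathrm{Diff}(\mathcal X)$, and suppose the action is induced by an affine representation on $\mathcal H$ with associated maps $b:G\to\mathcal H$ and $\pi:G\to\mathrm{GL}(\mathcal H)$. Let $g_0,g_1\in G$ and $\mu_i=\alpha(g_i)_\#\rho$, $i=0,1$. If there exists $h\in\mathrm{Stab}_G(\rho)$ such that the operator $\pi(g_1hg_0^{-1})$ is self-adjoint and positive semidefinite on $\mathcal H$, then: (i) $T_h(x)=b(g_1hg_0^{-1})+\pi(g_1hg_0^{-1})x$ solves the Monge problem between $\mu_0$ and $\mu_1$, and it is the unique optimal Monge map up to $\mu_0$-almost everywhere equality; (ii) $(\mathrm{id}_{\mathcal X},T_h)_\#\mu_0\in\Pi(\mu_0,\mu_1)$ solves the Kantorovich problem between $\mu_0$ and $\mu_1$, and it is the unique optimal Kantorovich plan; (iii) $h$ solves the Lie group orbit transport problem defining $\mathds J_c(g_0,g_1)$, i.e. $h$ attains its infimum; (iv) $\mathds K_c(\mu_0,\mu_1)=\mathds M_c(\mu_0,\mu_1)=\mathds J_c(g_0,g_1)$.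
   Context: $\mathcal P(\mathcal X)$ is the set of Borel probability measures on $\mathcal X$; $\mathcal L_{\mathcal H}$ is the Lebesgue measure on $\mathcal H$ induced by the Hilbert structure; $T_\#\mu(A)=\mu(T^{-1}(A))$. $\mathrm{GL}(\mathcal H)$ is the group of invertible linear maps of $\mathcal H$. The smooth action is given by a group homomorphism $\alpha:G\to\mathrm{Diff}(\mathcal X)$ such that $(g,x)\mapsto\alpha(g)(x)$ is smooth. It is induced by an affine representation on $\mathcal H$ if there are maps $b:G\to\mathcal H$, $\pi:G\to\mathrm{GL}(\mathcal H)$ with $\alpha(g)(x)=b(g)+\pi(g)x\in\mathcal X$ for all $g\in G$, $x\in\mathcal X$, and $\pi(g_1g_2)=\pi(g_1)\pi(g_2)$, $b(g_1g_2)=b(g_1)+\pi(g_1)b(g_2)$ for all $g_1,g_2\in G$. $\mathrm{Stab}_G(\rho)=\{h\in G:\alpha(h)_\#\rho=\rho\}$. Monge problem: $\mathds M_c(\mu_0,\mu_1)=\inf_{T}\int_{\mathcal X}c(x,T(x))\,d\mu_0(x)$ over Borel maps $T:\mathcal X\to\mathcal X$ with $T_\#\mu_0=\mu_1$. Kantorovich problem: $\mathds K_c(\mu_0,\mu_1)=\inf_{\Gamma\in\Pi(\mu_0,\mu_1)}\int c\,d\Gamma$, where $\Pi(\mu_0,\mu_1)$ is the set of probability measures on $\mathcal X\times\mathcal X$ with marginals $\mu_0,\mu_1$. Lie group orbit transport problem: $\mathds J_c(g_0,g_1)=\inf_{h\in\mathrm{Stab}_G(\rho)}\int_{\mathcal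 X}c(\alpha(g_0)(x),\alpha(g_1h)(x))\,d\rho(x)$. *)

theory Defs
  imports "HOL-Probability.Probability" "HOL-Algebra.Bij"
begin

text \<open>
  The following functions are meant for an open subset \<open>S\<close> of a finite-dimensional normed space, where
  \<open>Ck_on k S f\<close> says that all iterated directional derivatives of order at most \<open>k\<close> exist (as values
  of Frechet derivatives) and are continuous on \<open>S\<close>.
\<close>

primrec Ck_on ::
  "nat \<Rightarrow> 'a::real_normed_vector set \<Rightarrow> ('a \<Rightarrow> 'b::real_normed_vector) \<Rightarrow> bool"
where
  "Ck_on 0 S f \<longleftrightarrow> continuous_on S f"
| "Ck_on (Suc k) S f \<longleftrightarrow>
     (\<forall>x\<in>S. f differentiable (at x)) \<and>
     (\<forall>v. Ck_on k S (\<lambda>x. frechet_derivative f (at x) v))"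

definition smooth_on :: "'a::real_normed_vector set \<Rightarrow> ('a \<Rightarrow> 'b::real_normed_vector) \<Rightarrow> bool"
  where "smooth_on S f \<longleftrightarrow> (\<forall>k. Ck_on k S f)"

text \<open>
  A chart is a pair \<open>(U, \<phi>)\<close>; only the values of \<open>\<phi>\<close> on \<open>U\<close> matter. The model space is a
  finite-dimensional normed space rather than an instance of \<^class>\<open>euclidean_space\<close>, because
  the latter class excludes dimension zero and hence discrete Lie groups.
\<close>

type_synonym ('p, 'e) chart = "'p set \<times> ('p \<Rightarrow> 'e)"

definition is_chart :: "'p topology \<Rightarrow> ('p, 'e::real_normed_vector) chart \<Rightarrow> bool"
  where "is_chart T = (\<lambda>(U, \<phi>). openin T U \<and> open (\<phi> ` U) \<and>
           homeomorphic_map (subtopology T U) (top_of_set (\<phi> ` U)) \<phi>)"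

locale smooth_manifold =
  fixes T :: "'p topology" and A :: "('p, 'e::real_normed_vector) chart set"
  assumes hausdorff: "Hausdorff_space T"
    and second_countable: "second_countable T"
    and finite_dim: "\<exists>B :: 'e set. finite B \<and> span B = UNIV"
    and charts: "C \<in> A \<Longrightarrow> is_chart T C"
    and cover: "(\<Union>(U, \<phi>)\<in>A. U) = topspace T"
    and transition: "\<lbrakk>(U, \<phi>) \<in> A; (V, \<psi>) \<in> A\<rbrakk> \<Longrightarrow>
           smooth_on (\<phi> ` (U \<inter> V)) (\<psi> \<circ> inv_into U \<phi>)"

definition product_atlas ::
  "('p, 'd) chart set \<Rightarrow> ('q, 'e) chart set \<Rightarrow> ('p \<times> 'q, 'd \<times> 'e) chart set"
  where "product_atlas A B = {(U \<times> V, map_prod \<phi> \<psi>) | U \<phi> V \<psi>. (U, \<phi>) \<in> A \<and> (V, \<psi>) \<in> B}"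

definition smooth_map ::
  "'p topology \<Rightarrow> ('p, 'd::real_normed_vector) chart set \<Rightarrow>
   'q topology \<Rightarrow> ('q, 'e::real_normed_vector) chart set \<Rightarrow> ('p \<Rightarrow> 'q) \<Rightarrow> bool"
  where "smooth_map S A T B f \<longleftrightarrow> continuous_map S T f \<and>
     (\<forall>(U, \<phi>)\<in>A. \<forall>(V, \<psi>)\<in>B. smooth_on (\<phi> ` (U \<inter> f -` V)) (\<psi> \<circ> f \<circ> inv_into U \<phi>))"

locale lie_group = group G + smooth_manifold T A
  for G (structure) and T :: "'g topology" and A :: "('g, 'e::real_normed_vector) chart set" +
  assumes topspace_eq: "topspace T = carrier G"
    and smooth_mult:
      "smooth_map (prod_topology T T) (product_atlas A A) T A (\<lambda>(g, h). g \<otimes> h)"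
    and smooth_inv: "smooth_map T A T A (\<lambda>g. inv g)"

text \<open>As in \<^const>\<open>BijGroup\<close>, elements of \<open>Diff X\<close> are extensional, i.e. \<open>undefined\<close> outside \<open>X\<close>.\<close>

definition Diff :: "'h::real_normed_vector set \<Rightarrow> ('h \<Rightarrow> 'h) monoid"
  where "Diff X = (BijGroup X)
           \<lparr>carrier := {f \<in> Bij X. smooth_on X f \<and> smooth_on X (inv_into X f)}\<rparr>"

definition smooth_action ::
  "('g, 'm) monoid_scheme \<Rightarrow> 'g topology \<Rightarrow> ('g, 'e::real_normed_vector) chart set \<Rightarrow>
   'h::real_normed_vector set \<Rightarrow> ('g \<Rightarrow> 'h \<Rightarrow> 'h) \<Rightarrow> bool"
  where "smooth_action G T A X \<alpha> \<longleftrightarrow> \<alpha> \<in> hom G (Diff X) \<and>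
     smooth_map (prod_topology T (top_of_set X)) (product_atlas A {(X, id)})
       (top_of_set X) {(X, id)} (\<lambda>(g, x). \<alpha> g x)"

definition GL :: "('h::real_vector \<Rightarrow> 'h) set"
  where "GL = {L. linear L \<and> bij L}"

definition induced_by_affine_rep ::
  "('g, 'm) monoid_scheme \<Rightarrow> 'h::real_vector set \<Rightarrow> ('g \<Rightarrow> 'h \<Rightarrow> 'h) \<Rightarrow>
   ('g \<Rightarrow> 'h) \<Rightarrow> ('g \<Rightarrow> 'h \<Rightarrow> 'h) \<Rightarrow> bool"
  where "induced_by_affine_rep G X \<alpha> b \<pi> \<longleftrightarrow>
     (\<forall>g\<in>carrier G. \<pi> g \<in> GL) \<and>
     (\<forall>g\<in>carrier G. \<forall>x\<in>X. \<alpha> g x = b g + \<pi> g x \<and> b g + \<pi> g x \<in> X) \<and>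
     (\<forall>g1\<in>carrier G. \<forall>g2\<in>carrier G.
        \<pi> (g1 \<otimes>\<^bsub>G\<^esub> g2) = \<pi> g1 \<circ> \<pi> g2 \<and> b (g1 \<otimes>\<^bsub>G\<^esub> g2) = b g1 + \<pi> g1 (b g2))"

abbreviation borel_on :: "'h::topological_space set \<Rightarrow> 'h measure"
  where "borel_on X \<equiv> restrict_space borel X"

definition borel_probs :: "'h::topological_space set \<Rightarrow> 'h measure set"
  where "borel_probs X = {\<rho>. prob_space \<rho> \<and> sets \<rho> = sets (borel_on X)}"

definition Stab ::
  "('g, 'm) monoid_scheme \<Rightarrow> 'h::topological_space set \<Rightarrow> ('g \<Rightarrow> 'h \<Rightarrow> 'h) \<Rightarrow> 'h measure \<Rightarrow> 'g set"
  where "Stab G X \<alpha> \<rho> = {h \<in> carrier G. distr \<rho> (borel_on X) (\<alpha> h) = \<rho>}"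

definition sq_dist :: "'h::real_normed_vector \<Rightarrow> 'h \<Rightarrow> ennreal"
  where "sq_dist x y = ennreal ((norm (x - y))\<^sup>2)"

definition transport_maps :: "'a measure \<Rightarrow> 'b measure \<Rightarrow> ('a \<Rightarrow> 'b) set"
  where "transport_maps \<mu> \<nu> = {T \<in> measurable \<mu> \<nu>. distr \<mu> \<nu> T = \<nu>}"

definition monge_cost :: "('a \<Rightarrow> 'b \<Rightarrow> ennreal) \<Rightarrow> 'a measure \<Rightarrow> ('a \<Rightarrow> 'b) \<Rightarrow> ennreal"
  where "monge_cost c \<mu> T = (\<integral>\<^sup>+ x. c x (T x) \<partial>\<mu>)"

definition Monge :: "('a \<Rightarrow> 'b \<Rightarrow> ennreal) \<Rightarrow> 'a measure \<Rightarrow> 'b measure \<Rightarrow> ennreal"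
  where "Monge c \<mu> \<nu> = (INF T\<in>transport_maps \<mu> \<nu>. monge_cost c \<mu> T)"

definition monge_optimal ::
  "('a \<Rightarrow> 'b \<Rightarrow> ennreal) \<Rightarrow> 'a measure \<Rightarrow> 'b measure \<Rightarrow> ('a \<Rightarrow> 'b) \<Rightarrow> bool"
  where "monge_optimal c \<mu> \<nu> T \<longleftrightarrow> T \<in> transport_maps \<mu> \<nu> \<and> monge_cost c \<mu> T = Monge c \<mu> \<nu>"

definition couplings :: "'a measure \<Rightarrow> 'b measure \<Rightarrow> ('a \<times> 'b) measure set"
  where "couplings \<mu> \<nu> = {\<Gamma>. prob_space \<Gamma> \<and> sets \<Gamma> = sets (\<mu> \<Otimes>\<^sub>M \<nu>) \<and>
           distr \<Gamma> \<mu> fst = \<mu> \<and> distr \<Gamma> \<nu> snd = \<nu>}"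

definition kantorovich_cost :: "('a \<Rightarrow> 'b \<Rightarrow> ennreal) \<Rightarrow> ('a \<times> 'b) measure \<Rightarrow> ennreal"
  where "kantorovich_cost c \<Gamma> = (\<integral>\<^sup>+ (x, y). c x y \<partial>\<Gamma>)"

definition Kantorovich :: "('a \<Rightarrow> 'b \<Rightarrow> ennreal) \<Rightarrow> 'a measure \<Rightarrow> 'b measure \<Rightarrow> ennreal"
  where "Kantorovich c \<mu> \<nu> = (INF \<Gamma>\<in>couplings \<mu> \<nu>. kantorovich_cost c \<Gamma>)"

definition kantorovich_optimal ::
  "('a \<Rightarrow> 'b \<Rightarrow> ennreal) \<Rightarrow> 'a measure \<Rightarrow> 'b measure \<Rightarrow> ('a \<times> 'b) measure \<Rightarrow> bool"
  where "kantorovich_optimal c \<mu> \<nu> \<Gamma> \<longleftrightarrow>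
           \<Gamma> \<in> couplings \<mu> \<nu> \<and> kantorovich_cost c \<Gamma> = Kantorovich c \<mu> \<nu>"

definition orbit_cost ::
  "('g, 'm) monoid_scheme \<Rightarrow> ('g \<Rightarrow> 'h \<Rightarrow> 'h) \<Rightarrow> 'h measure \<Rightarrow> ('h \<Rightarrow> 'h \<Rightarrow> ennreal) \<Rightarrow>
   'g \<Rightarrow> 'g \<Rightarrow> 'g \<Rightarrow> ennreal"
  where "orbit_cost G \<alpha> \<rho> c g0 g1 h = (\<integral>\<^sup>+ x. c (\<alpha> g0 x) (\<alpha> (g1 \<otimes>\<^bsub>G\<^esub> h) x) \<partial>\<rho>)"

definition orbit_transport ::
  "('g, 'm) monoid_scheme \<Rightarrow> 'h::topological_space set \<Rightarrow> ('g \<Rightarrow> 'h \<Rightarrow> 'h) \<Rightarrow> 'h measure \<Rightarrow>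
   ('h \<Rightarrow> 'h \<Rightarrow> ennreal) \<Rightarrow> 'g \<Rightarrow> 'g \<Rightarrow> ennreal"
  where "orbit_transport G X \<alpha> \<rho> c g0 g1 = (INF h\<in>Stab G X \<alpha> \<rho>. orbit_cost G \<alpha> \<rho> c g0 g1 h)"

definition orbit_optimal ::
  "('g, 'm) monoid_scheme \<Rightarrow> 'h::topological_space set \<Rightarrow> ('g \<Rightarrow> 'h \<Rightarrow> 'h) \<Rightarrow> 'h measure \<Rightarrow>
   ('h \<Rightarrow> 'h \<Rightarrow> ennreal) \<Rightarrow> 'g \<Rightarrow> 'g \<Rightarrow> 'g \<Rightarrow> bool"
  where "orbit_optimal G X \<alpha> \<rho> c g0 g1 h \<longleftrightarrow>
           h \<in> Stab G X \<alpha> \<rho> \<and> orbit_cost G \<alpha> \<rho> c g0 g1 h = orbit_transport G X \<alpha> \<rho> c g0 g1"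

end

theory Submission
  imports Defs
begin

text \<open>
  Optimality is certified by an explicit solution of the dual Kantorovich problem. Put \<open>P = \<pi> k\<close> and
  \<open>a = b k\<close>, so that \<open>T x = a + P x\<close>. As \<open>P\<close> is self-adjoint, positive semidefinite and invertible,
  \<open>T\<close> is the gradient of the convex function \<open>x \<bullet> P x / 2 + a \<bullet> x\<close>, whose Legendre transform is
  \<open>P\<inverse> (y - a) \<bullet> (y - a) / 2\<close>. The two resulting potentials \<open>u x = x \<bullet> x - (2 a + P x) \<bullet> x\<close> and
  \<open>v y = y \<bullet> y - P\<inverse> (y - a) \<bullet> (y - a)\<close> satisfy
  \<open>|x - y|\<^sup>2 = u x + v y + P\<inverse> (y - T x) \<bullet> (y - T x)\<close>, in which the last summand is nonnegative and
  vanishes only for \<open>y = T x\<close> (lemmas \<open>sq_dist_potentials\<close> and \<open>potentials_feasible\<close>). Integrating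
  against a plan of \<open>\<mu>0\<close> and \<open>\<mu>1\<close> turns the first two summands into a constant that does not depend
  on the plan. Hence no plan costs less than this constant, and a plan attains it exactly if it is
  concentrated on the graph of \<open>T\<close>, which leaves a single plan (locale \<open>dual_certificate\<close>).

  Both other problems minimise the same cost over smaller families of plans: a Monge map \<open>S\<close> is the
  plan \<open>(id, S)\<^sub># \<mu>0\<close>, and an element \<open>h'\<close> of the stabiliser is the plan
  \<open>(\<alpha> g0, \<alpha> (g1 h'))\<^sub># \<rho>\<close>. The optimal plan belongs to both families, because
  \<open>T \<circ> \<alpha> g0 = \<alpha> (g1 h)\<close> on \<open>X\<close>; this gives the remaining optimality claims and makes the three
  infima agree.
\<close>

section \<open>Plans induced by pairs of maps\<close>

lemma pair_coupling:
  assumes "prob_space M" and f: "f \<in> transport_maps M \<mu>" and g: "g \<in> transport_maps M \<nu>"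
  shows "distr M (\<mu> \<Otimes>\<^sub>M \<nu>) (\<lambda>x. (f x, g x)) \<in> couplings \<mu> \<nu>"
proof -
  have [measurable]: "f \<in> measurable M \<mu>" "g \<in> measurable M \<nu>"
    and d: "distr M \<mu> f = \<mu>" "distr M \<nu> g = \<nu>"
    using f g by (auto simp: transport_maps_def)
  show ?thesis
    using d \<open>prob_space M\<close>
    by (auto simp: couplings_def distr_distr comp_def intro!: prob_space.prob_space_distr)
qed

lemma kantorovich_cost_pair:
  assumes "f \<in> transport_maps M \<mu>" and "g \<in> transport_maps M \<nu>"
    and c: "(\<lambda>(x, y). c x y) \<in> borel_measurable (\<mu> \<Otimes>\<^sub>M \<nu>)"
  shows "kantorovich_cost c (distr M (\<mu> \<Otimes>\<^sub>M \<nu>) (\<lambda>x. (f x, g x))) = (\<integral>\<^sup>+ x. c (f x) (g x) \<partial>M)"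
proof -
  have [measurable]: "f \<in> measurable M \<mu>" "g \<in> measurable M \<nu>"
    using assms by (auto simp: transport_maps_def)
  show ?thesis
    unfolding kantorovich_cost_def by (subst nn_integral_distr) (use c in auto)
qed

lemma id_transport_map: "(\<lambda>x. x) \<in> transport_maps \<mu> \<mu>"
  by (simp add: transport_maps_def)

lemma transport_map_distr:
  assumes [measurable]: "f \<in> measurable M N"
  shows "f \<in> transport_maps M (distr M N f)"
proof -
  have "distr M (distr M N f) f = distr M N f"
    by (rule distr_cong) simp_all
  then show ?thesis
    by (simp add: transport_maps_def)
qed

section \<open>Certifying optimality by a pair of potentials\<close>

text \<open>
  The potentials \<open>u\<close> and \<open>v\<close> are feasible for the dual problem, and complementary slackness with \<open>T\<close>
  holds in the strict form that equality occurs only on the graph of \<open>T\<close>. The strictness is what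
  yields uniqueness.
\<close>

locale dual_certificate =
  fixes \<mu> :: "'a measure" and \<nu> :: "'b measure" and c :: "'a \<Rightarrow> 'b \<Rightarrow> real"
    and u :: "'a \<Rightarrow> real" and v :: "'b \<Rightarrow> real" and T :: "'a \<Rightarrow> 'b"
  assumes prob: "prob_space \<mu>"
    and T_transport: "T \<in> transport_maps \<mu> \<nu>"
    and c_measurable [measurable]: "(\<lambda>(x, y). c x y) \<in> borel_measurable (\<mu> \<Otimes>\<^sub>M \<nu>)"
    and c_nonneg: "0 \<le> c x y"
    and u_integrable: "integrable \<mu> u" and v_integrable: "integrable \<nu> v"
    and feasible: "u x + v y \<le> c x y"
    and slackness: "u x + v y = c x y \<longleftrightarrow> y = T x"
begin

abbreviation cost :: "'a \<Rightarrow> 'b \<Rightarrow> ennreal"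
  where "cost \<equiv> \<lambda>x y. ennreal (c x y)"

abbreviation graph_plan :: "('a \<times> 'b) measure"
  where "graph_plan \<equiv> distr \<mu> (\<mu> \<Otimes>\<^sub>M \<nu>) (\<lambda>x. (x, T x))"

definition dual_value :: real
  where "dual_value = (\<integral>x. u x \<partial>\<mu>) + (\<integral>y. v y \<partial>\<nu>)"

lemma T_measurable [measurable]: "T \<in> measurable \<mu> \<nu>" and distr_T: "distr \<mu> \<nu> T = \<nu>"
  using T_transport by (auto simp: transport_maps_def)

lemma cost_measurable: "(\<lambda>(x, y). cost x y) \<in> borel_measurable (\<mu> \<Otimes>\<^sub>M \<nu>)"
  by measurable

lemma T_cost: "(\<integral>\<^sup>+ x. cost x (T x) \<partial>\<mu>) = ennreal dual_value"
  and dual_value_nonneg: "0 \<le> dual_value"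
proof -
  have c_T: "c x (T x) = u x + v (T x)" for x
    using slackness by metis
  have vT: "integrable \<mu> (\<lambda>x. v (T x))"
    by (metis T_measurable distr_T integrable_distr v_integrable)
  have "(\<integral>x. v (T x) \<partial>\<mu>) = (\<integral>y. v y \<partial>\<nu>)"
    by (metis T_measurable borel_measurable_integrable distr_T integral_distr v_integrable)
  then have val: "(\<integral>x. c x (T x) \<partial>\<mu>) = dual_value"
    using u_integrable vT by (simp add: c_T dual_value_def)
  show "0 \<le> dual_value"
    unfolding val [symmetric] by (simp add: c_nonneg)
  show "(\<integral>\<^sup>+ x. cost x (T x) \<partial>\<mu>) = ennreal dual_value"
    unfolding val [symmetric]
    by (rule nn_integral_eq_integral) (simp_all add: u_integrable vT c_T, simp add: c_nonneg flip: c_T)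
qed

context
  fixes \<Gamma> assumes \<Gamma>: "\<Gamma> \<in> couplings \<mu> \<nu>"
begin

lemma sets_plan [measurable_cong]: "sets \<Gamma> = sets (\<mu> \<Otimes>\<^sub>M \<nu>)"
  and plan_marginals: "distr \<Gamma> \<mu> fst = \<mu>" "distr \<Gamma> \<nu> snd = \<nu>"
  using \<Gamma> by (auto simp: couplings_def)

lemma integral_potentials:
  shows "integrable \<Gamma> (\<lambda>p. u (fst p) + v (snd p))"
    and "(\<integral>p. u (fst p) + v (snd p) \<partial>\<Gamma>) = dual_value"
proof -
  have fst: "fst \<in> measurable \<Gamma> \<mu>" and snd: "snd \<in> measurable \<Gamma> \<nu>"
    by measurable
  have "integrable \<Gamma> (\<lambda>p. u (fst p))" "integrable \<Gamma> (\<lambda>p. v (snd p))"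
    using integrable_distr [OF fst, of u] integrable_distr [OF snd, of v]
      u_integrable v_integrable by (simp_all add: plan_marginals)
  moreover have "(\<integral>p. u (fst p) \<partial>\<Gamma>) = (\<integral>x. u x \<partial>\<mu>)" "(\<integral>p. v (snd p) \<partial>\<Gamma>) = (\<integral>y. v y \<partial>\<nu>)"
    using integral_distr [OF fst, of u] integral_distr [OF snd, of v]
      borel_measurable_integrable [OF u_integrable] borel_measurable_integrable [OF v_integrable]
    by (simp_all add: plan_marginals)
  ultimately show "integrable \<Gamma> (\<lambda>p. u (fst p) + v (snd p))"
    and "(\<integral>p. u (fst p) + v (snd p) \<partial>\<Gamma>) = dual_value"
    by (simp_all add: dual_value_def)
qed

lemma finite_cost_plan:
  assumes "kantorovich_cost cost \<Gamma> < \<infinity>"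
  shows "integrable \<Gamma> (\<lambda>p. c (fst p) (snd p))"
    and "kantorovich_cost cost \<Gamma> = ennreal (\<integral>p. c (fst p) (snd p) \<partial>\<Gamma>)"
proof -
  have [measurable]: "(\<lambda>p. c (fst p) (snd p)) \<in> borel_measurable \<Gamma>"
    using c_measurable by (simp add: case_prod_beta' cong: measurable_cong_sets sets_plan)
  show int: "integrable \<Gamma> (\<lambda>p. c (fst p) (snd p))"
    using assms c_nonneg
    by (intro integrableI_nonneg) (auto simp: kantorovich_cost_def case_prod_beta')
  show "kantorovich_cost cost \<Gamma> = ennreal (\<integral>p. c (fst p) (snd p) \<partial>\<Gamma>)"
    using int c_nonneg by (simp add: kantorovich_cost_def case_prod_beta' nn_integral_eq_integral)
qed

lemma dual_value_le_cost: "ennreal dual_value \<le> kantorovich_cost cost \<Gamma>"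
proof (cases "kantorovich_cost cost \<Gamma> < \<infinity>")
  case True
  have "dual_value \<le> (\<integral>p. c (fst p) (snd p) \<partial>\<Gamma>)"
    unfolding integral_potentials(2) [symmetric]
    using integral_potentials(1) finite_cost_plan(1) [OF True] feasible by (rule integral_mono)
  then show ?thesis
    by (simp add: finite_cost_plan(2) [OF True] ennreal_leI)
next
  case False
  then show ?thesis
    by (simp add: less_top [symmetric])
qed

text \<open>
  A plan of minimal cost makes the nonnegative gap \<open>c - u - v\<close> integrate to zero, so it is concentrated
  on the graph of \<open>T\<close>, and a plan on that graph is determined by its first marginal.
\<close>

lemma plan_on_graph:
  assumes "kantorovich_cost cost \<Gamma> = ennreal dual_value"
  shows "AE p in \<Gamma>. snd p = T (fst p)"
proof -
  have fin: "kantorovich_cost cost \<Gamma> < \<infinity>"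
    using assms by simp
  let ?gap = "\<lambda>p. c (fst p) (snd p) - (u (fst p) + v (snd p))"
  have "(\<integral>p. c (fst p) (snd p) \<partial>\<Gamma>) = dual_value"
    using assms finite_cost_plan(2) [OF fin] dual_value_nonneg
    by (simp add: c_nonneg)
  then have "integrable \<Gamma> ?gap" "(\<integral>p. ?gap p \<partial>\<Gamma>) = 0"
    using finite_cost_plan(1) [OF fin] integral_potentials by simp_all
  then have "AE p in \<Gamma>. ?gap p = 0"
    using integral_nonneg_eq_0_iff_AE [of \<Gamma> ?gap] feasible by simp
  then show ?thesis
    by eventually_elim (simp flip: slackness)
qed

lemma plan_eq_graph_plan:
  assumes "kantorovich_cost cost \<Gamma> = ennreal dual_value"
  shows "\<Gamma> = graph_plan"
proof -
  have on_graph: "AE p in \<Gamma>. p = (fst p, T (fst p))"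
    using plan_on_graph [OF assms] by eventually_elim (simp add: prod_eq_iff)
  have "\<Gamma> = distr \<Gamma> (\<mu> \<Otimes>\<^sub>M \<nu>) (\<lambda>p. p)"
    using distr_id2 [OF sets_plan [symmetric]] by simp
  also have "\<dots> = distr \<Gamma> (\<mu> \<Otimes>\<^sub>M \<nu>) (\<lambda>p. (fst p, T (fst p)))"
    by (rule distr_cong_AE) (use on_graph in auto)
  also have "\<dots> = distr (distr \<Gamma> \<mu> fst) (\<mu> \<Otimes>\<^sub>M \<nu>) (\<lambda>x. (x, T x))"
    by (simp add: distr_distr comp_def)
  finally show ?thesis
    by (simp add: plan_marginals)
qed

end

lemma graph_plan_coupling: "graph_plan \<in> couplings \<mu> \<nu>"
  by (rule pair_coupling [OF prob id_transport_map T_transport])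

lemma graph_plan_cost: "kantorovich_cost cost graph_plan = ennreal dual_value"
  by (simp add: kantorovich_cost_pair id_transport_map T_transport cost_measurable T_cost)

lemma Kantorovich_eq: "Kantorovich cost \<mu> \<nu> = ennreal dual_value"
  unfolding Kantorovich_def
proof (rule antisym)
  show "(INF \<Gamma>\<in>couplings \<mu> \<nu>. kantorovich_cost cost \<Gamma>) \<le> ennreal dual_value"
    by (rule INF_lower2 [OF graph_plan_coupling]) (simp add: graph_plan_cost)
qed (auto intro: INF_greatest dual_value_le_cost)

lemma graph_plan_optimal: "kantorovich_optimal cost \<mu> \<nu> graph_plan"
  by (simp add: kantorovich_optimal_def graph_plan_coupling graph_plan_cost Kantorovich_eq)

lemma optimal_plan_unique: "kantorovich_optimal cost \<mu> \<nu> \<Gamma> \<Longrightarrow> \<Gamma> = graph_plan"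
  by (simp add: kantorovich_optimal_def plan_eq_graph_plan Kantorovich_eq)

lemma dual_value_le_pair_cost:
  assumes "prob_space M" "f \<in> transport_maps M \<mu>" "g \<in> transport_maps M \<nu>"
  shows "ennreal dual_value \<le> (\<integral>\<^sup>+ x. cost (f x) (g x) \<partial>M)"
  using dual_value_le_cost [OF pair_coupling [OF assms]]
  by (simp add: kantorovich_cost_pair assms cost_measurable)

lemma Monge_eq: "Monge cost \<mu> \<nu> = ennreal dual_value"
  unfolding Monge_def
proof (rule antisym)
  show "(INF S\<in>transport_maps \<mu> \<nu>. monge_cost cost \<mu> S) \<le> ennreal dual_value"
    by (rule INF_lower2 [OF T_transport]) (simp add: monge_cost_def T_cost)
qed (auto intro!: INF_greatest dual_value_le_pair_cost prob id_transport_map simp: monge_cost_def)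

lemma T_optimal: "monge_optimal cost \<mu> \<nu> T"
  by (simp add: monge_optimal_def T_transport Monge_eq monge_cost_def T_cost)

text \<open>
  Deducing \<open>S = T\<close> almost everywhere from equality of the plans of \<open>S\<close> and \<open>T\<close> would require the graph
  of \<open>T\<close> to be measurable. It is enough to know that the plan of \<open>S\<close> is concentrated on this graph.
\<close>

lemma optimal_map_unique:
  assumes S: "monge_optimal cost \<mu> \<nu> S"
  shows "AE x in \<mu>. S x = T x"
proof -
  have S_transport: "S \<in> transport_maps \<mu> \<nu>"
    and S_cost: "(\<integral>\<^sup>+ x. cost x (S x) \<partial>\<mu>) = ennreal dual_value"
    using S by (simp_all add: monge_optimal_def Monge_eq monge_cost_def)
  have [measurable]: "S \<in> measurable \<mu> \<nu>"
    using S_transport by (auto simp: transport_maps_def)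
  let ?\<Gamma> = "distr \<mu> (\<mu> \<Otimes>\<^sub>M \<nu>) (\<lambda>x. (x, S x))"
  have \<Gamma>: "?\<Gamma> \<in> couplings \<mu> \<nu>"
    by (rule pair_coupling [OF prob id_transport_map S_transport])
  have cost: "kantorovich_cost cost ?\<Gamma> = ennreal dual_value"
    by (simp add: kantorovich_cost_pair id_transport_map S_transport cost_measurable S_cost)
  have "(\<lambda>x. (x, S x)) \<in> measurable \<mu> (\<mu> \<Otimes>\<^sub>M \<nu>)"
    by measurable
  from AE_distrD [OF this plan_on_graph [OF \<Gamma> cost]] show ?thesis
    by simp
qed

end

section \<open>Potentials for an affine map with positive linear part\<close>

text \<open>
  The first-order term of \<open>(z + t P z) \<bullet> P (z + t P z)\<close> in \<open>t\<close> is \<open>2 t |P z|\<^sup>2\<close>; if the constant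
  term vanishes, nonnegativity for small negative \<open>t\<close> forces \<open>P z = 0\<close>.
\<close>

lemma psd_form_eq_0_imp:
  fixes P :: "'h::euclidean_space \<Rightarrow> 'h"
  assumes "linear P" and self_adj: "\<And>x y. P x \<bullet> y = x \<bullet> P y" and psd: "\<And>x. 0 \<le> x \<bullet> P x"
    and "z \<bullet> P z = 0"
  shows "P z = 0"
proof (rule ccontr)
  interpret linear P by fact
  let ?w = "P z"
  assume "?w \<noteq> 0"
  then have a: "0 < ?w \<bullet> ?w" by simp
  have expand: "(z + t *\<^sub>R ?w) \<bullet> P (z + t *\<^sub>R ?w) = 2 * t * (?w \<bullet> ?w) + t\<^sup>2 * (?w \<bullet> P ?w)" for t
    using \<open>z \<bullet> P z = 0\<close>
    by (simp add: add scaleR inner_add_left inner_add_right self_adj [symmetric] power2_eq_square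
        algebra_simps)
  let ?b = "?w \<bullet> P ?w"
  \<comment> \<open>\<open>2 t |P z|\<^sup>2 + t\<^sup>2 b\<close> is negative for \<open>t\<close> strictly between \<open>- 2 |P z|\<^sup>2 / b\<close> and \<open>0\<close>; the
    added 1 keeps the choice of \<open>t\<close> meaningful if \<open>b = 0\<close>.\<close>
  define t where "t = - (?w \<bullet> ?w) / (?b + 1)"
  have b: "0 \<le> ?b" by (rule psd)
  have t: "t < 0" and tb: "t * (?b + 1) = - (?w \<bullet> ?w)"
    using a b by (auto simp: t_def divide_neg_pos)
  have "2 * t * (?w \<bullet> ?w) + t\<^sup>2 * ?b = t * (2 * (?w \<bullet> ?w) + t * (?b + 1) - t)"
    by (simp add: power2_eq_square algebra_simps)
  also have "\<dots> < 0"
    using t a less_trans [OF t a] unfolding tb by (intro mult_neg_pos) auto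
  finally show False
    using psd [of "z + t *\<^sub>R ?w"] unfolding expand by simp
qed

text \<open>
  The source potential is \<open>|x|\<^sup>2 - 2 \<phi> x\<close> for \<open>\<phi> x = x \<bullet> P x / 2 + a \<bullet> x\<close>, the convex function with gradient
  \<open>a + P x\<close>, and the target potential is \<open>|y|\<^sup>2 - 2 \<phi>\<^sup>* y\<close> for its Legendre transform \<open>\<phi>\<^sup>*\<close>. The
  subtracted products are kept as inner products of two affine maps, the form in which their
  integrability is shown.
\<close>

definition source_potential :: "('h::real_inner \<Rightarrow> 'h) \<Rightarrow> 'h \<Rightarrow> 'h \<Rightarrow> real"
  where "source_potential P a x = x \<bullet> x - (2 *\<^sub>R a + P x) \<bullet> x"

definition target_potential :: "('h::real_inner \<Rightarrow> 'h) \<Rightarrow> 'h \<Rightarrow> 'h \<Rightarrow> real"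
  where "target_potential P a y = y \<bullet> y - (- inv_into UNIV P a + inv_into UNIV P y) \<bullet> (- a + y)"

text \<open>
  The squared distance exceeds the sum of the potentials by twice the gap in the Fenchel-Young
  inequality for \<open>\<phi>\<close> at \<open>(x, y)\<close>. Completing the square turns this excess into the quadratic form of \<open>P\<close>
  at the preimage \<open>z\<close> of \<open>y - (a + P x)\<close>.
\<close>

lemma sq_dist_potentials:
  fixes P :: "'h::euclidean_space \<Rightarrow> 'h"
  assumes "linear P" "bij P" and self_adj: "\<And>x y. P x \<bullet> y = x \<bullet> P y"
    and z: "P z = y - (a + P x)"
  shows "(norm (x - y))\<^sup>2 = source_potential P a x + target_potential P a y + z \<bullet> P z"
proof -
  interpret linear P by fact
  \<comment> \<open>Expressing \<open>y\<close> by a preimage of \<open>y - a\<close> removes the inverse of \<open>P\<close> from the computation.\<close>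
  have Py: "y = a + P (x + z)"
    using z by (simp add: add)
  interpret R: linear "inv_into UNIV P"
    using assms(1,2) by (simp add: inj_linear_imp_inv_linear bij_is_inj)
  have Ry: "inv_into UNIV P y = inv_into UNIV P a + (x + z)"
    unfolding Py by (simp add: R.add inv_f_f bij_is_inj [OF \<open>bij P\<close>])
  have "target_potential P a y = y \<bullet> y - (x + z) \<bullet> P (x + z)"
    unfolding target_potential_def Ry by (simp add: Py)
  moreover have "z \<bullet> P x = x \<bullet> P z"
    by (metis inner_commute self_adj)
  ultimately show ?thesis
    by (simp add: source_potential_def Py power2_norm_eq_inner add inner_simps inner_commute
        algebra_simps)
qed

lemma potentials_feasible:
  fixes P :: "'h::euclidean_space \<Rightarrow> 'h"
  assumes P: "linear P" "bij P" and self_adj: "\<And>x y. P x \<bullet> y = x \<bullet> P y"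
    and psd: "\<And>x. 0 \<le> x \<bullet> P x"
  shows "source_potential P a x + target_potential P a y \<le> (norm (x - y))\<^sup>2"
    and "source_potential P a x + target_potential P a y = (norm (x - y))\<^sup>2 \<longleftrightarrow> y = a + P x"
proof -
  obtain z where z: "P z = y - (a + P x)"
    using \<open>bij P\<close> by (metis bij_pointE)
  note eq = sq_dist_potentials [OF P self_adj z]
  show "source_potential P a x + target_potential P a y \<le> (norm (x - y))\<^sup>2"
    using psd [of z] by (simp add: eq)
  have "z \<bullet> P z = 0 \<longleftrightarrow> P z = 0"
    using psd_form_eq_0_imp [OF \<open>linear P\<close> self_adj psd] by auto
  then show "source_potential P a x + target_potential P a y = (norm (x - y))\<^sup>2 \<longleftrightarrow> y = a + P x"
    by (auto simp: eq z)
qed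

section \<open>Quadratic integrability\<close>

text \<open>
  Inner products of affine maps cover both kinds of integrands that occur: the squared norm composed
  with an affine action, and the quadratic parts of the potentials.
\<close>

lemma integrable_inner_affine:
  fixes L M :: "'h::euclidean_space \<Rightarrow> 'h"
  assumes "finite_measure \<mu>" and sets: "sets \<mu> = sets (borel_on X)"
    and mom: "integrable \<mu> (\<lambda>x. x \<bullet> x)"
    and L: "linear L" and M: "linear M"
  shows "integrable \<mu> (\<lambda>x. (a + L x) \<bullet> (a' + M x))"
proof -
  interpret finite_measure \<mu> by fact
  obtain K where K: "\<And>x. norm (L x) \<le> K * norm x"
    using linear_bounded [OF L] by blast
  obtain K' where K': "\<And>x. norm (M x) \<le> K' * norm x"
    using linear_bounded [OF M] by blast
  let ?f = "\<lambda>x. (norm a)\<^sup>2 + K\<^sup>2 * (x \<bullet> x) + ((norm a')\<^sup>2 + K'\<^sup>2 * (x \<bullet> x))"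
  have f: "integrable \<mu> ?f"
    using mom by simp
  have bound: "(norm (p + N x))\<^sup>2 / 2 \<le> (norm p)\<^sup>2 + B\<^sup>2 * (x \<bullet> x)"
    if "\<And>x. norm (N x) \<le> B * norm x" for p :: 'h and N B and x :: 'h
  proof -
    have "(norm (N x))\<^sup>2 \<le> (B * norm x)\<^sup>2"
      by (rule power_mono) (use that in auto)
    moreover have "norm (p + N x) \<le> norm p + norm (N x)"
      by (rule norm_triangle_ineq)
    then have "(norm (p + N x))\<^sup>2 \<le> (norm p + norm (N x))\<^sup>2"
      by (rule power_mono) auto
    moreover have "(norm p + norm (N x))\<^sup>2 \<le> 2 * (norm p)\<^sup>2 + 2 * (norm (N x))\<^sup>2"
      using sum_squares_bound [of "norm p" "norm (N x)"] by (simp add: power2_sum)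
    ultimately show ?thesis
      by (simp add: power_mult_distrib power2_norm_eq_inner)
  qed
  have "norm ((a + L x) \<bullet> (a' + M x)) \<le> norm (?f x)" for x
  proof -
    have "\<bar>(a + L x) \<bullet> (a' + M x)\<bar> \<le> norm (a + L x) * norm (a' + M x)"
      by (rule Cauchy_Schwarz_ineq2)
    also have "\<dots> \<le> (norm (a + L x))\<^sup>2 / 2 + (norm (a' + M x))\<^sup>2 / 2"
      using sum_squares_bound [of "norm (a + L x)" "norm (a' + M x)"] by simp
    also have "\<dots> \<le> ?f x"
      by (intro add_mono bound K K')
    finally show ?thesis by simp
  qed
  then have ae: "AE x in \<mu>. norm ((a + L x) \<bullet> (a' + M x)) \<le> norm (?f x)"
    by simp
  have "continuous_on UNIV (\<lambda>x. (a + L x) \<bullet> (a' + M x))"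
    using L M by (intro continuous_intros linear_continuous_on) (simp_all add: linear_conv_bounded_linear)
  then have "(\<lambda>x. (a + L x) \<bullet> (a' + M x)) \<in> borel_measurable \<mu>"
    by (simp add: borel_measurable_continuous_onI measurable_restrict_space1
        cong: measurable_cong_sets [OF sets refl])
  from f this ae show ?thesis
    by (rule Bochner_Integration.integrable_bound)
qed

lemma affine_measurable:
  fixes L :: "'h::euclidean_space \<Rightarrow> 'h"
  assumes "linear L" and "\<And>x. x \<in> X \<Longrightarrow> f x = a + L x" and "\<And>x. x \<in> X \<Longrightarrow> f x \<in> X"
  shows "f \<in> measurable (borel_on X) (borel_on X)"
proof (rule measurable_restrict_space2)
  show "f \<in> space (borel_on X) \<rightarrow> X"
    using assms(3) by (simp add: space_restrict_space)
  have "continuous_on UNIV (\<lambda>x. a + L x)"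
    using \<open>linear L\<close>
    by (intro continuous_intros linear_continuous_on) (simp add: linear_conv_bounded_linear)
  then have "(\<lambda>x. a + L x) \<in> measurable (borel_on X) borel"
    by (simp add: borel_measurable_continuous_onI measurable_restrict_space1)
  moreover have "f \<in> measurable (borel_on X) borel \<longleftrightarrow> (\<lambda>x. a + L x) \<in> measurable (borel_on X) borel"
    by (rule measurable_cong) (simp add: assms(2) space_restrict_space)
  ultimately show "f \<in> measurable (borel_on X) borel"
    by simp
qed

lemma sq_dist_measurable:
  fixes \<mu> \<nu> :: "'h::euclidean_space measure"
  assumes "sets \<mu> = sets (borel_on X)" "sets \<nu> = sets (borel_on X)"
  shows "(\<lambda>(x, y). (norm (x - y))\<^sup>2) \<in> borel_measurable (\<mu> \<Otimes>\<^sub>M \<nu>)"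
proof -
  have id: "(\<lambda>x. x) \<in> borel_measurable \<mu>" "(\<lambda>x. x) \<in> borel_measurable \<nu>"
    using assms by (simp_all add: measurable_restrict_space1 cong: measurable_cong_sets)
  have [measurable]: "fst \<in> borel_measurable (\<mu> \<Otimes>\<^sub>M \<nu>)" "snd \<in> borel_measurable (\<mu> \<Otimes>\<^sub>M \<nu>)"
    by (rule measurable_compose [OF measurable_fst id(1)] measurable_compose [OF measurable_snd id(2)])+
  show ?thesis
    unfolding case_prod_beta' by measurable
qed

text \<open>
  Brenier's theorem for the gradient of a positive definite quadratic function, with the dual
  solution given in closed form.
\<close>

proposition affine_dual_certificate:
  fixes P :: "'h::euclidean_space \<Rightarrow> 'h"
  assumes "prob_space \<mu>" and sets: "sets \<mu> = sets (borel_on X)" "sets \<nu> = sets (borel_on X)"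
    and mom: "integrable \<mu> (\<lambda>x. x \<bullet> x)" "integrable \<nu> (\<lambda>y. y \<bullet> y)"
    and T: "(\<lambda>x. a + P x) \<in> transport_maps \<mu> \<nu>"
    and P: "linear P" "bij P" and self_adj: "\<And>x y. P x \<bullet> y = x \<bullet> P y" and psd: "\<And>x. 0 \<le> x \<bullet> P x"
  shows "dual_certificate \<mu> \<nu> (\<lambda>x y. (norm (x - y))\<^sup>2)
    (source_potential P a) (target_potential P a) (\<lambda>x. a + P x)"
proof (rule dual_certificate.intro)
  interpret \<mu>: prob_space \<mu> by fact
  have "prob_space \<nu>"
    using T \<mu>.prob_space_distr by (metis (mono_tags, lifting) mem_Collect_eq transport_maps_def)
  then interpret \<nu>: prob_space \<nu> .
  have R: "linear (inv_into UNIV P)"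
    using P by (simp add: inj_linear_imp_inv_linear bij_is_inj)
  show "integrable \<mu> (source_potential P a)"
    unfolding source_potential_def
    using mom(1) integrable_inner_affine [OF \<mu>.finite_measure_axioms sets(1) mom(1) P(1) linear_id,
        of "2 *\<^sub>R a" 0]
    by simp
  show "integrable \<nu> (target_potential P a)"
    unfolding target_potential_def
    using mom(2) integrable_inner_affine [OF \<nu>.finite_measure_axioms sets(2) mom(2) R linear_id,
        of "- inv_into UNIV P a" "- a"]
    by simp
  show "prob_space \<mu>" by fact
qed (use T sq_dist_measurable [OF sets] potentials_feasible [OF P self_adj psd] in auto)

section \<open>Transport within an orbit of an affine action\<close>

lemma affine_action_mult:
  assumes "group G" "induced_by_affine_rep G X \<alpha> b \<pi>"
    and "g \<in> carrier G" "g' \<in> carrier G" "x \<in> X"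
  shows "\<alpha> (g \<otimes>\<^bsub>G\<^esub> g') x = \<alpha> g (\<alpha> g' x)"
proof -
  interpret group G by fact
  have "linear (\<pi> g)"
    using assms by (simp add: induced_by_affine_rep_def GL_def)
  moreover have "\<alpha> (g \<otimes>\<^bsub>G\<^esub> g') x = b g + \<pi> g (b g') + \<pi> g (\<pi> g' x)"
    and "\<alpha> g (\<alpha> g' x) = b g + \<pi> g (b g' + \<pi> g' x)"
    using assms by (simp_all add: induced_by_affine_rep_def)
  ultimately show ?thesis
    by (simp add: linear_add)
qed

theorem theorem4p2:
  fixes X :: "'h::euclidean_space set"
    and G :: "('g, 'm) monoid_scheme"
    and \<T> :: "'g topology"
    and A :: "('g, 'e::real_normed_vector) chart set"
    and \<alpha> \<pi> :: "'g \<Rightarrow> 'h \<Rightarrow> 'h"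
    and b :: "'g \<Rightarrow> 'h"
    and \<rho> \<mu>0 \<mu>1 :: "'h measure"
    and g0 g1 h k :: 'g
    and T :: "'h \<Rightarrow> 'h"
  assumes "open X" "convex X" "X \<noteq> {}"
    and "\<rho> \<in> borel_probs X"
    and "absolutely_continuous (restrict_space lborel X) \<rho>"
    and "(\<integral>\<^sup>+ x. ennreal ((norm x)\<^sup>2) \<partial>\<rho>) < \<infinity>"
    and "lie_group G \<T> A"
    and "smooth_action G \<T> A X \<alpha>"
    and "induced_by_affine_rep G X \<alpha> b \<pi>"
    and "g0 \<in> carrier G" "g1 \<in> carrier G"
    and "\<mu>0 = distr \<rho> (borel_on X) (\<alpha> g0)"
    and "\<mu>1 = distr \<rho> (borel_on X) (\<alpha> g1)"
    and "h \<in> Stab G X \<alpha> \<rho>"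
    and "k = g1 \<otimes>\<^bsub>G\<^esub> h \<otimes>\<^bsub>G\<^esub> inv\<^bsub>G\<^esub> g0"
    and "adjoint (\<pi> k) = \<pi> k" "\<forall>v. 0 \<le> v \<bullet> \<pi> k v"
    and "T = (\<lambda>x. b k + \<pi> k x)"
  shows "(monge_optimal sq_dist \<mu>0 \<mu>1 T \<and>
           (\<forall>S. monge_optimal sq_dist \<mu>0 \<mu>1 S \<longrightarrow> (AE x in \<mu>0. S x = T x))) \<and>
         (distr \<mu>0 (\<mu>0 \<Otimes>\<^sub>M \<mu>1) (\<lambda>x. (x, T x)) \<in> couplings \<mu>0 \<mu>1 \<and>
           kantorovich_optimal sq_dist \<mu>0 \<mu>1 (distr \<mu>0 (\<mu>0 \<Otimes>\<^sub>M \<mu>1) (\<lambda>x. (x, T x))) \<and>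
           (\<forall>\<Gamma>. kantorovich_optimal sq_dist \<mu>0 \<mu>1 \<Gamma> \<longrightarrow>
                 \<Gamma> = distr \<mu>0 (\<mu>0 \<Otimes>\<^sub>M \<mu>1) (\<lambda>x. (x, T x)))) \<and>
         orbit_optimal G X \<alpha> \<rho> sq_dist g0 g1 h \<and>
         Kantorovich sq_dist \<mu>0 \<mu>1 = Monge sq_dist \<mu>0 \<mu>1 \<and>
         Monge sq_dist \<mu>0 \<mu>1 = orbit_transport G X \<alpha> \<rho> sq_dist g0 g1"
proof -
  interpret lie_group G \<T> A by fact
  note rep = \<open>induced_by_affine_rep G X \<alpha> b \<pi>\<close> and g = \<open>g0 \<in> carrier G\<close> \<open>g1 \<in> carrier G\<close>
    and \<mu> = \<open>\<mu>0 = distr \<rho> (borel_on X) (\<alpha> g0)\<close> \<open>\<mu>1 = distr \<rho> (borel_on X) (\<alpha> g1)\<close>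
  note act_mult = affine_action_mult [OF group_axioms rep]
  have h: "h \<in> carrier G"
    using \<open>h \<in> Stab G X \<alpha> \<rho>\<close> by (simp add: Stab_def)
  then have k: "k \<in> carrier G" "k \<otimes>\<^bsub>G\<^esub> g0 = g1 \<otimes>\<^bsub>G\<^esub> h"
    using g \<open>k = _\<close> by (simp_all add: m_assoc)
  have lin: "linear (\<pi> g)" and bij: "bij (\<pi> g)" and act: "x \<in> X \<Longrightarrow> \<alpha> g x = b g + \<pi> g x"
    and act_X: "x \<in> X \<Longrightarrow> \<alpha> g x \<in> X" if "g \<in> carrier G" for g x
    using rep that by (auto simp: induced_by_affine_rep_def GL_def)
  interpret \<rho>: prob_space \<rho>
    using \<open>\<rho> \<in> borel_probs X\<close> by (simp add: borel_probs_def)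
  have sets_\<rho>: "sets \<rho> = sets (borel_on X)"
    using \<open>\<rho> \<in> borel_probs X\<close> by (simp add: borel_probs_def)
  then have space_\<rho>: "space \<rho> = X"
    by (simp add: sets_eq_imp_space_eq space_restrict_space)
  have sets_\<mu>: "sets \<mu>0 = sets (borel_on X)" "sets \<mu>1 = sets (borel_on X)"
    by (simp_all add: \<mu>)
  have act_meas: "\<alpha> g \<in> measurable (borel_on X) (borel_on X)" if "g \<in> carrier G" for g
    by (rule affine_measurable [OF lin act act_X]) (use that in auto)
  then have act_\<rho>: "\<alpha> g \<in> measurable \<rho> (borel_on X)" if "g \<in> carrier G" for g
    using that by (simp cong: measurable_cong_sets [OF sets_\<rho> refl])

  have push_mult: "distr \<rho> (borel_on X) (\<alpha> (g \<otimes>\<^bsub>G\<^esub> g')) =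
      distr (distr \<rho> (borel_on X) (\<alpha> g')) (borel_on X) (\<alpha> g)"
    if "g \<in> carrier G" "g' \<in> carrier G" for g g'
  proof -
    have "distr \<rho> (borel_on X) (\<alpha> (g \<otimes>\<^bsub>G\<^esub> g')) = distr \<rho> (borel_on X) (\<alpha> g \<circ> \<alpha> g')"
      by (rule distr_cong) (simp_all add: act_mult that space_\<rho>)
    then show ?thesis
      by (simp add: distr_distr act_meas act_\<rho> that)
  qed
  have push_stab: "distr \<rho> (borel_on X) (\<alpha> (g1 \<otimes>\<^bsub>G\<^esub> h')) = \<mu>1" if "h' \<in> Stab G X \<alpha> \<rho>" for h'
    using that g by (simp add: push_mult \<mu> Stab_def)
  have to_\<mu>0: "\<alpha> g0 \<in> transport_maps \<rho> \<mu>0"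
    unfolding \<mu>(1) by (rule transport_map_distr [OF act_\<rho> [OF g(1)]])
  have to_\<mu>1: "\<alpha> (g1 \<otimes>\<^bsub>G\<^esub> h') \<in> transport_maps \<rho> \<mu>1" if "h' \<in> Stab G X \<alpha> \<rho>" for h'
    using transport_map_distr [OF act_\<rho>, of "g1 \<otimes>\<^bsub>G\<^esub> h'"] g that
    unfolding push_stab [OF that] by (simp add: Stab_def)

  have T_act: "T (\<alpha> g0 x) = \<alpha> (g1 \<otimes>\<^bsub>G\<^esub> h) x" if "x \<in> X" for x
    using that k g act_mult [of k g0 x] act [OF k(1)] act_X by (simp add: \<open>T = _\<close>)
  have "T \<in> measurable (borel_on X) (borel_on X)"
    using act [OF k(1)] act_X [OF k(1)]
    by (intro affine_measurable [OF lin [OF k(1)], of X T "b k"]) (simp_all add: \<open>T = _\<close>)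
  then have T_meas: "T \<in> measurable \<mu>0 \<mu>1"
    using sets_\<mu> by (simp cong: measurable_cong_sets)
  have "distr \<mu>0 \<mu>1 T = distr \<rho> \<mu>1 (\<lambda>x. T (\<alpha> g0 x))"
    using to_\<mu>0 T_meas distr_distr [of T \<mu>0 \<mu>1 "\<alpha> g0" \<rho>]
    by (simp add: transport_maps_def comp_def)
  also have "\<dots> = distr \<rho> \<mu>1 (\<alpha> (g1 \<otimes>\<^bsub>G\<^esub> h))"
    by (rule distr_cong) (simp_all add: T_act space_\<rho>)
  also have "\<dots> = \<mu>1"
    using to_\<mu>1 [OF \<open>h \<in> Stab G X \<alpha> \<rho>\<close>] by (simp add: transport_maps_def)
  finally have T_transport: "(\<lambda>x. b k + \<pi> k x) \<in> transport_maps \<mu>0 \<mu>1"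
    using T_meas by (simp add: transport_maps_def \<open>T = _\<close>)

  have id_X: "(\<lambda>x. x) \<in> borel_measurable (borel_on X)"
    by (simp add: measurable_restrict_space1)
  have mom_\<rho>: "integrable \<rho> (\<lambda>x. x \<bullet> x)"
  proof (rule integrableI_nonneg)
    show "(\<lambda>x. x \<bullet> x) \<in> borel_measurable \<rho>"
      using id_X by (simp cong: measurable_cong_sets [OF sets_\<rho> refl])
  qed (use \<open>(\<integral>\<^sup>+ x. ennreal ((norm x)\<^sup>2) \<partial>\<rho>) < \<infinity>\<close> in \<open>simp_all add: power2_norm_eq_inner\<close>)
  have mom: "integrable (distr \<rho> (borel_on X) (\<alpha> g)) (\<lambda>x. x \<bullet> x)" if "g \<in> carrier G" for g
  proof (subst integrable_distr_eq [OF act_\<rho> [OF that]])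
    have "integrable \<rho> (\<lambda>x. (b g + \<pi> g x) \<bullet> (b g + \<pi> g x))"
      using lin [OF that] by (intro integrable_inner_affine [OF \<rho>.finite_measure_axioms sets_\<rho> mom_\<rho>])
    then show "integrable \<rho> (\<lambda>x. \<alpha> g x \<bullet> \<alpha> g x)"
      by (rule Bochner_Integration.integrable_cong [THEN iffD1, rotated 2])
        (simp_all add: act that space_\<rho>)
  qed (use id_X in simp)

  have self_adj: "\<pi> k x \<bullet> y = x \<bullet> \<pi> k y" for x y
    using adjoint_works [OF lin [OF k(1)], of x y] \<open>adjoint (\<pi> k) = \<pi> k\<close> by (simp add: inner_commute)
  have "prob_space \<mu>0"
    using act_\<rho> [OF g(1)] by (simp add: \<mu> \<rho>.prob_space_distr)
  then interpret dual_certificate \<mu>0 \<mu>1 "\<lambda>x y. (norm (x - y))\<^sup>2"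
    "source_potential (\<pi> k) (b k)" "target_potential (\<pi> k) (b k)" T
    unfolding \<open>T = _\<close> using sets_\<mu> mom g T_transport lin bij k self_adj \<open>\<forall>v. 0 \<le> v \<bullet> \<pi> k v\<close>
    by (intro affine_dual_certificate) (simp_all add: \<mu>)
  have cost: "cost = sq_dist"
    by (simp add: fun_eq_iff sq_dist_def)

  have orbit_le: "ennreal dual_value \<le> orbit_cost G \<alpha> \<rho> sq_dist g0 g1 h'"
    if "h' \<in> Stab G X \<alpha> \<rho>" for h'
    using dual_value_le_pair_cost [OF \<rho>.prob_space_axioms to_\<mu>0 to_\<mu>1 [OF that]]
    by (simp add: orbit_cost_def sq_dist_def)
  have "orbit_cost G \<alpha> \<rho> sq_dist g0 g1 h = (\<integral>\<^sup>+ x. cost (\<alpha> g0 x) (T (\<alpha> g0 x)) \<partial>\<rho>)"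
    unfolding orbit_cost_def by (rule nn_integral_cong) (simp add: T_act space_\<rho> sq_dist_def)
  also have "\<dots> = (\<integral>\<^sup>+ x. cost x (T x) \<partial>distr \<rho> \<mu>0 (\<alpha> g0))"
    using to_\<mu>0 cost_measurable by (subst nn_integral_distr) (auto simp: transport_maps_def)
  also have "\<dots> = ennreal dual_value"
    using to_\<mu>0 T_cost by (simp add: transport_maps_def)
  finally have orbit_h: "orbit_cost G \<alpha> \<rho> sq_dist g0 g1 h = ennreal dual_value" .
  have orbit: "orbit_transport G X \<alpha> \<rho> sq_dist g0 g1 = ennreal dual_value"
    unfolding orbit_transport_def
  proof (rule antisym)
    show "(INF h\<in>Stab G X \<alpha> \<rho>. orbit_cost G \<alpha> \<rho> sq_dist g0 g1 h) \<le> ennreal dual_value"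
      by (rule INF_lower2 [OF \<open>h \<in> Stab G X \<alpha> \<rho>\<close>]) (simp add: orbit_h)
  qed (auto intro: INF_greatest orbit_le)

  have "orbit_optimal G X \<alpha> \<rho> sq_dist g0 g1 h"
    using \<open>h \<in> Stab G X \<alpha> \<rho>\<close> orbit_h orbit by (simp add: orbit_optimal_def)
  moreover have "Kantorovich sq_dist \<mu>0 \<mu>1 = Monge sq_dist \<mu>0 \<mu>1"
    and "Monge sq_dist \<mu>0 \<mu>1 = orbit_transport G X \<alpha> \<rho> sq_dist g0 g1"
    using Kantorovich_eq Monge_eq orbit unfolding cost by (simp_all only:)
  ultimately show ?thesis
    using T_optimal [unfolded cost] optimal_map_unique [unfolded cost] graph_plan_coupling
      graph_plan_optimal [unfolded cost] optimal_plan_unique [unfolded cost]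
    by (intro conjI allI impI)
qed

end
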